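(* Let $\mathcal{D}$ be a quantitative database with an arbitrary total order on its items, and let $\mu$ and $M$ be two positive integers such that $\mu\le M$. Then the algorithm QPlus (described in the context) directly draws a pattern from $\mathcal{D}$ with a length in the range $[\mu..M]$ according to a distribution that is proportional to its weighted utility; that is, for every $\varphi\in\mathcal{L}_{[\mu..M]}(\mathcal{D})$, the probability that QPlus outputs $\varphi$ is $$\frac{\mathbb{U}(\varphi,\mathcal{D})\,\mathbb{L}_{[\mu..M]}(|\varphi|)}{Z},\qquad Z=\sum_{\varphi'\in\mathcal{L}_{[\mu..M]}(\mathcal{D})}\mathbb{U}(\varphi',\mathcal{D})\,\mathbb{L}_{[\mu..M]}(|\varphi'|).$$
   Context: Items come from a finite totally ordered set $\mathcal{I}$. A quantitative transaction $t$ is a set of $|t|$ distinct items, listed in order as $t[1],\dots,t[|t|]$, where each $X\in t$ carries a quantity $q(X,t)$. Each item $X$ has a user-defined weight $p(X)>0$, and $\omega(X,t)=q(X,t)\,p(X)$. A quantitative database $\mathcal{D}$ is a multiset of quantitative transactions (sums over $t\in\mathcal{D}$ count multiplicity). A pattern is a nonempty subset $\varphi\subseteq\mathcal{I}$, with length $|\varphi|$. Its utility in $t$ is $u(\varphi,t)=\sum_{X\in\varphi}\omega(X,t)$ if $\varphi\subseteq t$, and $0$ otherwise; put also $u(\emptyset,t)=0$. Its utility in $\mathcal{D}$ is $\mathbb{U}(\varphi,\mathcal{D})=\sum_{t\in\mathcal{D}}u(\varphi,t)$. $\mathcal{L}_{[\mu..M]}(\mathcal{D})$ is the set of patterns occurring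 in $\mathcal{D}$ (contained in at least one transaction) whose length lies in $[\mu..M]$. A length-based utility is a function $\mathbb{L}_{[\mu..M]}:\mathbb{N}^*\to\mathbb{R}^+$ with $\mathbb{L}_{[\mu..M]}(\ell)=0$ for $\ell\notin[\mu..M]$; one such function is fixed. The weighted utility of $\varphi$ is $\mathbb{U}(\varphi,\mathcal{D})\,\mathbb{L}_{[\mu..M]}(|\varphi|)$. The upper triangle utility $\mathcal{V}_t$ of a transaction $t$ is defined by: $\mathcal{V}_t(\ell,i)=0$ if $\ell>i$ (in particular $\mathcal{V}_t(\ell,0)=0$ for $\ell\ge1$); $\mathcal{V}_t(1,i)=\sum_{j=1}^{i}\omega(t[j],t)$; and $\mathcal{V}_t(\ell,i)=\binom{i-1}{\ell-1}\omega(t[i],t)+\mathcal{V}_t(\ell-1,i-1)+\mathcal{V}_t(\ell,i-1)$ for $2\le\ell\le i\le|t|$. Algorithm QPlus on input $(\mathcal{D},\mu,M)$: 1. For each $t\in\mathcal{D}$ compute $W_{[\mu..M]}(t)=\sum_{\ell=\mu}^{M}\mathcal{V}_t(\ell,|t|)\,\mathbb{L}_{[\mu..M]}(\ell)$ (terms with $\ell>|t|$ are $0$). 2. Draw a transaction $t\in\mathcal{D}$ with probability proportional to $W_{[\mu..M]}(t)$, i.e. with probability $W_{[\mu..M]}(t)/\sum_{t'\in\mathcal{D}}W_{[\mu..M]}(t')$. 3. Draw an integer $\ell$ from $\mu$ to $M$ with probability $\mathcal{V}_t(\ell,|t|)\,\mathbb{L}_{[\mu..M]}(\ell)/W_{[\mu..M]}(t)$.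 4. Set $\varphi\leftarrow\emptyset$ and $j\leftarrow|t|$. 5. While $\ell>0$, do the following. (a) Set $\alpha\leftarrow r\cdot\bigl(\mathcal{V}_t(\ell,j)+\binom{j-1}{\ell-1}u(\varphi,t)\bigr)$, where $r$ is a fresh uniform random number in $(0,1)$. (b) Let $i$ be the index such that $b_{\inf}(i)<\alpha\le b_{\sup}(i)$, where $b_{\inf}(i)=\mathcal{V}_t(\ell,i-1)+\binom{i-1}{\ell}u(\varphi,t)$ and $b_{\sup}(i)=\mathcal{V}_t(\ell,i)+\binom{i-1}{\ell-1}u(\varphi,t)$. (c) Set $\varphi\leftarrow\{t[i]\}\cup\varphi$ and $\ell\leftarrow\ell-1$. (d) Set $j\leftarrow i$ (jump to the position indexed by $i$). 6. Return $\varphi$.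
   Formalization: As printed, step 5 can pick t[i] twice (two unit items, μ=M=2: {t[2]} has probability 1/3). Mended: 5a uses V_t(ℓ,j)+C(j,ℓ)u(φ,t), 5b uses b_sup(i)=V_t(ℓ,i)+C(i,ℓ)u(φ,t), 5d sets j←i−1. Quantities are assumed nonnegative. *)

theory Defs
  imports "HOL-Probability.Probability"
begin

(* A transaction is a partial map from items to quantities: its domain is the set of its items,
   and the (t X) is the quantity q(X,t). Databases are multisets of such maps. *)
type_synonym 'a transaction = "'a \<rightharpoonup> real"

definition tlen :: "'a transaction \<Rightarrow> nat" where
  "tlen t = card (dom t)"

(* t[i], with positions 1, ..., |t| *)
definition item :: "('a::linorder) transaction \<Rightarrow> nat \<Rightarrow> 'a" where
  "item t i = sorted_list_of_set (dom t) ! (i - 1)"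

definition omega :: "('a \<Rightarrow> real) \<Rightarrow> 'a \<Rightarrow> 'a transaction \<Rightarrow> real" where
  "omega p X t = the (t X) * p X"

definition utility :: "('a \<Rightarrow> real) \<Rightarrow> 'a set \<Rightarrow> 'a transaction \<Rightarrow> real" where
  "utility p \<phi> t = (if \<phi> \<subseteq> dom t then \<Sum>X\<in>\<phi>. omega p X t else 0)"

definition db_utility :: "('a \<Rightarrow> real) \<Rightarrow> 'a set \<Rightarrow> 'a transaction multiset \<Rightarrow> real" where
  "db_utility p \<phi> D = (\<Sum>t\<in>#D. utility p \<phi> t)"

definition patterns :: "nat \<Rightarrow> nat \<Rightarrow> 'a transaction multiset \<Rightarrow> 'a set set" where
  "patterns \<mu> M D = {\<phi>. \<phi> \<noteq> {} \<and> (\<exists>t\<in>#D. \<phi> \<subseteq> dom t) \<and> card \<phi> \<in> {\<mu>..M}}"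

(* L 0 is left unconstrained: the domain of a length-based utility is the positive integers. *)
definition length_utility :: "nat \<Rightarrow> nat \<Rightarrow> (nat \<Rightarrow> real) \<Rightarrow> bool" where
  "length_utility \<mu> M L \<longleftrightarrow> (\<forall>l\<ge>1. 0 \<le> L l \<and> (l \<notin> {\<mu>..M} \<longrightarrow> L l = 0))"

definition weighted_utility ::
  "('a \<Rightarrow> real) \<Rightarrow> (nat \<Rightarrow> real) \<Rightarrow> 'a transaction multiset \<Rightarrow> 'a set \<Rightarrow> real" where
  "weighted_utility p L D \<phi> = db_utility p \<phi> D * L (card \<phi>)"

(* Lengths are positive in the source; the value 0 at length 0 is a dummy and is never used. *)
function (sequential) upper_triangle ::
  "('a::linorder \<Rightarrow> real) \<Rightarrow> 'a transaction \<Rightarrow> nat \<Rightarrow> nat \<Rightarrow> real" where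
  "upper_triangle p t l i =
     (if l = 0 \<or> l > i then 0
      else if l = 1 then \<Sum>j=1..i. omega p (item t j) t
      else real ((i - 1) choose (l - 1)) * omega p (item t i) t
           + upper_triangle p t (l - 1) (i - 1) + upper_triangle p t l (i - 1))"
  by pat_completeness auto
termination by (relation "Wellfounded.measure (\<lambda>(p, t, l, i). i)") auto

declare upper_triangle.simps [simp del]

definition trans_weight ::
  "('a::linorder \<Rightarrow> real) \<Rightarrow> (nat \<Rightarrow> real) \<Rightarrow> nat \<Rightarrow> nat \<Rightarrow> 'a transaction \<Rightarrow> real" where
  "trans_weight p L \<mu> M t = (\<Sum>l=\<mu>..M. upper_triangle p t l (tlen t) * L l)"

(* Each of the count D t occurrences of t is drawn with probability weight / total. If the total
   weight is 0 there is nothing to draw, and the result is failure (all the mass on None). *)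
definition draw_transaction ::
  "('a::linorder \<Rightarrow> real) \<Rightarrow> (nat \<Rightarrow> real) \<Rightarrow> nat \<Rightarrow> nat \<Rightarrow> 'a transaction multiset \<Rightarrow>
   'a transaction spmf" where
  "draw_transaction p L \<mu> M D = embed_spmf
     (\<lambda>t. real (count D t) * trans_weight p L \<mu> M t / (\<Sum>t'\<in>#D. trans_weight p L \<mu> M t'))"

definition draw_length ::
  "('a::linorder \<Rightarrow> real) \<Rightarrow> (nat \<Rightarrow> real) \<Rightarrow> nat \<Rightarrow> nat \<Rightarrow> 'a transaction \<Rightarrow> nat spmf" where
  "draw_length p L \<mu> M t = embed_spmf
     (\<lambda>l. if l \<in> {\<mu>..M} then upper_triangle p t l (tlen t) * L l / trans_weight p L \<mu> M t else 0)"

(* The bounds of the jump. The source prints the coefficient of u(phi,t) in b_sup(i), and in the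
   upper limit of alpha, as (i-1 choose l-1) and (j-1 choose l-1), and continues after a jump to i
   with j = i. Read literally, the intervals (b_inf(i), b_sup(i)] may leave gaps once phi is
   nonempty, and t[i] can be selected again: on a single transaction of two items of weight 1 with
   l = 2, the outcome {t[2]} has probability 1/3, so the sampler is not exact. What is used here
   is b_sup(i) = b_inf(i+1), with b_inf as printed, i.e. the coefficient (i choose l); the upper
   limit of alpha is b_sup(j); and the next item is sought strictly before position i. The
   bounds agree with the printed ones whenever phi is empty. *)
definition b_inf ::
  "('a::linorder \<Rightarrow> real) \<Rightarrow> 'a transaction \<Rightarrow> 'a set \<Rightarrow> nat \<Rightarrow> nat \<Rightarrow> real" where
  "b_inf p t \<phi> l i = upper_triangle p t l (i - 1) + real ((i - 1) choose l) * utility p \<phi> t"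

definition b_sup ::
  "('a::linorder \<Rightarrow> real) \<Rightarrow> 'a transaction \<Rightarrow> 'a set \<Rightarrow> nat \<Rightarrow> nat \<Rightarrow> real" where
  "b_sup p t \<phi> l i = upper_triangle p t l i + real (i choose l) * utility p \<phi> t"

definition is_jump ::
  "('a::linorder \<Rightarrow> real) \<Rightarrow> 'a transaction \<Rightarrow> 'a set \<Rightarrow> nat \<Rightarrow> real \<Rightarrow> nat \<Rightarrow> bool" where
  "is_jump p t \<phi> l \<alpha> i \<longleftrightarrow> i \<in> {1..tlen t} \<and> b_inf p t \<phi> l i < \<alpha> \<and> \<alpha> \<le> b_sup p t \<phi> l i"

(* r is the uniform random number; None if the index is not well defined. *)
definition jump ::
  "('a::linorder \<Rightarrow> real) \<Rightarrow> 'a transaction \<Rightarrow> 'a set \<Rightarrow> nat \<Rightarrow> nat \<Rightarrow> real \<Rightarrow> nat option" where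
  "jump p t \<phi> l j r =
     (let \<alpha> = r * (upper_triangle p t l j + real (j choose l) * utility p \<phi> t)
      in if \<exists>!i. is_jump p t \<phi> l \<alpha> i then Some (THE i. is_jump p t \<phi> l \<alpha> i) else None)"

(* The law of jump under r uniform on (0,1), as a discrete (sub)distribution. *)
definition draw_index ::
  "('a::linorder \<Rightarrow> real) \<Rightarrow> 'a transaction \<Rightarrow> 'a set \<Rightarrow> nat \<Rightarrow> nat \<Rightarrow> nat spmf" where
  "draw_index p t \<phi> l j =
     Abs_pmf (distr (uniform_measure lborel {0<..<1}) (count_space UNIV) (jump p t \<phi> l j))"

lemma measurable_jump: "jump p t \<phi> l j \<in> measurable borel (count_space UNIV)"
proof -
  define S where "S = upper_triangle p t l j + real (j choose l) * utility p \<phi> t"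
  define A where "A i = {r. is_jump p t \<phi> l (r * S) i}" for i
  have jump_A: "jump p t \<phi> l j r =
      (if \<exists>!i. r \<in> A i then Some (THE i. r \<in> A i) else None)" for r
    by (simp add: jump_def Let_def S_def A_def)
  have A: "A i \<in> sets borel" for i
  proof (cases "i \<in> {1..tlen t}")
    case True
    then have "A i = {r. b_inf p t \<phi> l i < r * S} \<inter> {r. r * S \<le> b_sup p t \<phi> l i}"
      by (auto simp: A_def is_jump_def)
    moreover have "open {r. b_inf p t \<phi> l i < r * S}" "closed {r. r * S \<le> b_sup p t \<phi> l i}"
      by (intro open_Collect_less closed_Collect_le continuous_intros)+
    ultimately show ?thesis
      by (metis borel_open borel_closed sets.Int)
  next
    case False
    then have "A i = {}" by (auto simp: A_def is_jump_def)
    then show ?thesis by simp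
  qed
  have Some_iff: "jump p t \<phi> l j r = Some i \<longleftrightarrow> r \<in> A i \<and> (\<forall>k. k \<noteq> i \<longrightarrow> r \<notin> A k)" for r i
  proof
    assume "jump p t \<phi> l j r = Some i"
    then have ex: "\<exists>!i. r \<in> A i" and i: "(THE i. r \<in> A i) = i"
      by (simp_all add: jump_A split: if_splits)
    from theI' [OF ex] ex show "r \<in> A i \<and> (\<forall>k. k \<noteq> i \<longrightarrow> r \<notin> A k)"
      unfolding i by blast
  next
    assume *: "r \<in> A i \<and> (\<forall>k. k \<noteq> i \<longrightarrow> r \<notin> A k)"
    then have ex: "\<exists>!i. r \<in> A i" by (intro ex1I [of _ i]) auto
    moreover from * have "(THE i. r \<in> A i) = i" by (intro the_equality) auto
    ultimately show "jump p t \<phi> l j r = Some i" by (simp add: jump_A)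
  qed
  have Some_sets: "jump p t \<phi> l j -` {Some i} \<in> sets borel" for i
  proof -
    have "jump p t \<phi> l j -` {Some i} = A i - (\<Union>k\<in>UNIV - {i}. A k)"
      by (auto simp: Some_iff)
    then show ?thesis using A by auto
  qed
  have "jump p t \<phi> l j -` {None} = UNIV - (\<Union>i. jump p t \<phi> l j -` {Some i})"
    by (auto simp del: not_None_eq)
  also have "\<dots> \<in> sets borel"
    using Some_sets by (intro sets.Diff sets.countable_UN) auto
  finally have "jump p t \<phi> l j -` {x} \<inter> space borel \<in> sets borel" for x
    using Some_sets by (cases x) simp_all
  then show ?thesis
    by (subst measurable_count_space_eq2_countable) auto
qed

lemma measure_pmf_draw_index:
  "measure_pmf (draw_index p t \<phi> l j) =
     distr (uniform_measure lborel {0<..<1}) (count_space UNIV) (jump p t \<phi> l j)"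
proof -
  let ?U = "uniform_measure lborel {0<..<1::real}"
  let ?M = "distr ?U (count_space UNIV) (jump p t \<phi> l j)"
  interpret U: prob_space ?U by (rule prob_space_uniform_measure) auto
  have "jump p t \<phi> l j \<in> measurable ?U (count_space UNIV)"
    by (subst measurable_cong_sets [of _ borel _ "count_space UNIV"]) (simp_all add: measurable_jump)
  then interpret D: prob_space ?M by (rule U.prob_space_distr)
  have "AE x in ?M. measure ?M {x} \<noteq> 0"
    by (subst D.AE_support_countable) (auto intro!: exI [of _ UNIV])
  then show ?thesis
    unfolding draw_index_def by (intro Abs_pmf_inverse) (simp add: D.prob_space_axioms)
qed

fun qplus_loop ::
  "('a::linorder \<Rightarrow> real) \<Rightarrow> 'a transaction \<Rightarrow> nat \<Rightarrow> nat \<Rightarrow> 'a set \<Rightarrow> 'a set spmf" where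
  "qplus_loop p t 0 j \<phi> = return_spmf \<phi>"
| "qplus_loop p t (Suc l) j \<phi> =
     bind_spmf (draw_index p t \<phi> (Suc l) j)
       (\<lambda>i. qplus_loop p t l (i - 1) ({item t i} \<union> \<phi>))"

definition QPlus ::
  "('a::linorder \<Rightarrow> real) \<Rightarrow> (nat \<Rightarrow> real) \<Rightarrow> 'a transaction multiset \<Rightarrow> nat \<Rightarrow> nat \<Rightarrow>
   'a set spmf" where
  "QPlus p L D \<mu> M =
     bind_spmf (draw_transaction p L \<mu> M D)
       (\<lambda>t. bind_spmf (draw_length p L \<mu> M t)
         (\<lambda>l. qplus_loop p t l (tlen t) {}))"

end

(* The closed form V_t(l,i) = (i-1 choose l-1) * (omega(t[1],t) + ... + omega(t[i],t)) shows that
   for phi outside the first i positions, b_sup(i) = V_t(l,i) + (i choose l) u(phi,t) is the total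
   utility of all the sets phi Un A, where A consists of l of the first i items of t. A jump goes
   to i <= j with probability (b_sup(i) - b_sup(i-1)) / b_sup(j), and the numerator is the
   normalising constant b_sup(i-1) of the next round, for the set phi with t[i] added. The product
   of these probabilities telescopes to u(phi Un A,t) / b_sup(j). Summed over lengths and
   transactions, the constants V_t(l,|t|) and W(t) cancel in the same way. *)
theory Submission
  imports Defs
begin

section \<open>Point masses of subdistributions, and lengths of intervals\<close>

text \<open>The integral giving the mass at \<open>y\<close> has an integrand that vanishes outside
  \<open>A\<close>. Only points from which \<open>y\<close> can be reached have to lie in
  \<open>A\<close>, so a singleton suffices where the outcome determines the intermediate
  value.\<close>

lemma spmf_bind_finite:
  assumes "finite A" and "\<And>x. x \<in> set_spmf P \<Longrightarrow> spmf (f x) y \<noteq> 0 \<Longrightarrow> x \<in> A"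
  shows "spmf (bind_spmf P f) y = (\<Sum>x\<in>A. spmf P x * spmf (f x) y)"
proof -
  have "ennreal (spmf (bind_spmf P f) y) =
      (\<integral>\<^sup>+ x. ennreal (spmf P x) * ennreal (spmf (f x) y) \<partial>count_space UNIV)"
    by (simp add: ennreal_spmf_bind nn_integral_measure_spmf)
  also have "\<dots> = (\<Sum>x\<in>A. ennreal (spmf P x) * ennreal (spmf (f x) y))"
    using assms by (intro nn_integral_count_space') (auto simp: spmf_eq_0_set_spmf)
  also have "\<dots> = ennreal (\<Sum>x\<in>A. spmf P x * spmf (f x) y)"
    by (simp add: sum_ennreal flip: ennreal_mult)
  finally show ?thesis by (simp add: sum_nonneg)
qed

lemma spmf_embed_spmf_finite:
  fixes f :: "'b \<Rightarrow> real"
  assumes "finite A" and "\<And>x. x \<notin> A \<Longrightarrow> f x = 0" and nonneg: "\<And>x. 0 \<le> f x" and "sum f A \<le> 1"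
  shows "spmf (embed_spmf f) x = f x"
proof -
  have "(\<integral>\<^sup>+ x. ennreal (f x) \<partial>count_space UNIV) = (\<Sum>x\<in>A. ennreal (f x))"
    using assms by (intro nn_integral_count_space') auto
  also have "\<dots> \<le> 1"
    using assms by (simp add: sum_ennreal)
  finally show ?thesis
    using nonneg[of x] by (simp add: spmf_embed_spmf)
qed

text \<open>The intersection drops at most the endpoint 1, a null set. In the law of the jump,
  \<open>a\<close> and \<open>b\<close> are the scaled ends of an interval for \<alpha>.\<close>

lemma measure_Ioc_inter_unit:
  fixes a b :: real
  assumes "0 \<le> a" "a \<le> b" "b \<le> 1"
  shows "measure lborel ({a<..b} \<inter> {0<..<1}) = b - a"
proof (cases "b = 1")
  case True
  then have "{a<..b} \<inter> {0<..<1} = {a<..<b}" using assms by auto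
  then show ?thesis using assms by simp
next
  case False
  then have "{a<..b} \<inter> {0<..<1} = {a<..b}" using assms by auto
  then show ?thesis using assms by simp
qed

section \<open>Double counting and the closed form of V_t\<close>

text \<open>Double counting: each element of \<open>S\<close> lies in as many of the sets
  \<open>A\<close> as there are subsets of size \<open>l\<close> of the remaining elements.\<close>

lemma sum_sum_subsets_card:
  fixes w :: "'b \<Rightarrow> real"
  assumes "finite S"
  shows "(\<Sum>A | A \<subseteq> S \<and> card A = Suc l. sum w A) = real ((card S - 1) choose l) * sum w S"
proof -
  let ?F = "{A. A \<subseteq> S \<and> card A = Suc l}"
  have fin: "finite ?F" using assms by simp
  have count: "card {A \<in> ?F. x \<in> A} = (card S - 1) choose l" if "x \<in> S" for x
  proof -
    have "bij_betw (insert x) {B. B \<subseteq> S - {x} \<and> card B = l} {A \<in> ?F. x \<in> A}"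
    proof (rule bij_betwI[where g = "\<lambda>A. A - {x}"])
      show "insert x \<in> {B. B \<subseteq> S - {x} \<and> card B = l} \<rightarrow> {A \<in> ?F. x \<in> A}"
        using that assms finite_subset by (fastforce simp: card_insert_if)
      show "(\<lambda>A. A - {x}) \<in> {A \<in> ?F. x \<in> A} \<rightarrow> {B. B \<subseteq> S - {x} \<and> card B = l}"
        by auto
    qed auto
    then have "card {A \<in> ?F. x \<in> A} = card {B. B \<subseteq> S - {x} \<and> card B = l}"
      by (simp add: bij_betw_same_card)
    also have "\<dots> = (card S - 1) choose l"
      using assms that by (simp add: n_subsets)
    finally show ?thesis .
  qed
  have "(\<Sum>A\<in>?F. sum w A) = (\<Sum>A\<in>?F. \<Sum>x\<in>{x \<in> S. x \<in> A}. w x)"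
    by (intro sum.cong refl) auto
  also have "\<dots> = (\<Sum>x\<in>S. \<Sum>A\<in>{A \<in> ?F. x \<in> A}. w x)"
    using fin assms by (rule sum.swap_restrict)
  also have "\<dots> = (\<Sum>x\<in>S. real ((card S - 1) choose l) * w x)"
    by (intro sum.cong refl) (simp only: sum_constant count)
  finally show ?thesis by (simp add: sum_distrib_left)
qed

text \<open>For lengths above 1, the recursion leaves two binomials in front of the prefix sum up to
  i-1, and Pascal's rule adds them to (i-1 choose l), the coefficient of omega(t[i],t).\<close>

lemma upper_triangle_closed_form:
  "upper_triangle p t (Suc l) i = real ((i - 1) choose l) * (\<Sum>j=1..i. omega p (item t j) t)"
proof (induction i arbitrary: l)
  case 0
  then show ?case by (subst upper_triangle.simps) simp
next
  case (Suc i)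
  show ?case
  proof (cases l)
    case 0
    then show ?thesis by (subst upper_triangle.simps) simp
  next
    case (Suc k)
    then show ?thesis
    \<comment> \<open>Truncated subtraction makes Pascal's rule fail for \<open>i - 1\<close> at
      \<open>i = 0\<close>, so this position is separate.\<close>
    proof (cases i)
      case 0
      then show ?thesis using Suc by (subst upper_triangle.simps) simp
    next
      case (Suc m)
      show ?thesis
      proof (cases "l \<le> i")
        case True
        then have "upper_triangle p t (Suc l) (Suc i) = real (i choose l) * omega p (item t (Suc i)) t
           + upper_triangle p t l i + upper_triangle p t (Suc l) i"
          using \<open>l = Suc k\<close> by (subst upper_triangle.simps) simp
        then show ?thesis
          using \<open>l = Suc k\<close> by (simp add: Suc.IH) (simp add: \<open>i = Suc m\<close> algebra_simps)
      next
        case False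
        then show ?thesis by (subst upper_triangle.simps) (simp add: binomial_eq_0)
      qed
    qed
  qed
qed

section \<open>Algebra of the jump bounds\<close>

lemma upper_triangle_length_0 [simp]: "upper_triangle p t 0 i = 0"
  by (subst upper_triangle.simps) simp

text \<open>Consecutive intervals abut, so the jump can be described by \<open>b_sup\<close> and its
  increments alone.\<close>

lemma b_inf_eq_b_sup: "b_inf p t \<phi> l i = b_sup p t \<phi> l (i - 1)"
  by (simp add: b_inf_def b_sup_def)

lemma b_sup_length_0 [simp]: "b_sup p t \<phi> 0 j = utility p \<phi> t"
  by (simp add: b_sup_def)

lemma b_sup_position_0 [simp]: "b_sup p t \<phi> (Suc l) 0 = 0"
  by (simp add: b_sup_def upper_triangle_closed_form)

text \<open>Pascal's rule gives omega(t[i+1],t) and u(phi,t) the same coefficient (i choose l) in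
  the increment. In the use made of this, \<open>\<psi>\<close> is \<open>\<phi>\<close> with t[i+1]
  added, and both sides total the utilities of the choices whose last item is t[i+1].\<close>

lemma b_sup_Suc_diff:
  assumes "utility p \<psi> t = omega p (item t (Suc i)) t + utility p \<phi> t"
  shows "b_sup p t \<phi> (Suc l) (Suc i) - b_sup p t \<phi> (Suc l) i = b_sup p t \<psi> l i"
proof (cases l)
  case 0
  then show ?thesis using assms by (simp add: b_sup_def upper_triangle_closed_form algebra_simps)
next
  case (Suc k)
  then show ?thesis using assms
    by (cases i) (simp_all add: b_sup_def upper_triangle_closed_form algebra_simps)
qed

section \<open>One transaction: the law of the jump\<close>

text \<open>\<open>omega\<close> may vanish, so utilities and normalising constants can be 0; the
  degenerate quotients x/0 = 0 are therefore treated below.\<close>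

locale weighted_transaction =
  fixes p :: "'a::linorder \<Rightarrow> real" and t :: "'a transaction"
  assumes finite_dom: "finite (dom t)"
    and omega_nonneg: "X \<in> dom t \<Longrightarrow> 0 \<le> omega p X t"
begin

lemma utility_nonneg: "0 \<le> utility p \<phi> t"
  by (auto simp: utility_def intro!: sum_nonneg omega_nonneg)

lemma utility_insert:
  assumes "\<phi> \<subseteq> dom t" "X \<in> dom t" "X \<notin> \<phi>"
  shows "utility p (insert X \<phi>) t = omega p X t + utility p \<phi> t"
  using assms finite_dom by (auto simp: utility_def finite_subset)

lemma bij_betw_item: "bij_betw (item t) {1..tlen t} (dom t)"
proof -
  have "bij_betw ((!) (sorted_list_of_set (dom t))) {..<tlen t} (dom t)"
    using finite_dom by (intro bij_betw_nth) (simp_all add: tlen_def)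
  moreover have "bij_betw (\<lambda>i. i - 1) {1..tlen t} {..<tlen t}"
    by (rule bij_betwI[where g = Suc]) auto
  ultimately have "bij_betw ((!) (sorted_list_of_set (dom t)) \<circ> (\<lambda>i. i - 1)) {1..tlen t} (dom t)"
    by (rule bij_betw_trans[rotated])
  then show ?thesis by (simp add: item_def [abs_def] comp_def)
qed

lemma item_image: "item t ` {1..tlen t} = dom t"
  using bij_betw_item by (rule bij_betw_imp_surj_on)

lemma item_in_dom: "1 \<le> i \<Longrightarrow> i \<le> tlen t \<Longrightarrow> item t i \<in> dom t"
  using item_image by auto

lemma item_eq_iff:
  "\<lbrakk>1 \<le> i; i \<le> tlen t; 1 \<le> k; k \<le> tlen t\<rbrakk> \<Longrightarrow> item t i = item t k \<longleftrightarrow> i = k"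
  using bij_betw_imp_inj_on[OF bij_betw_item] by (auto simp: inj_on_eq_iff)

text \<open>In the closed form the binomials and the prefix sums both grow with the position. The
  bound by \<open>tlen t\<close> keeps \<open>item\<close> inside the transaction, where
  \<open>omega\<close> is nonnegative.\<close>

lemma b_sup_mono:
  assumes "i \<le> k" "k \<le> tlen t"
  shows "b_sup p t \<phi> (Suc l) i \<le> b_sup p t \<phi> (Suc l) k"
proof -
  have nonneg: "0 \<le> omega p (item t j) t" if "j \<in> {1..k}" for j
    using that assms by (intro omega_nonneg item_in_dom) auto
  have "(\<Sum>j=1..i. omega p (item t j) t) \<le> (\<Sum>j=1..k. omega p (item t j) t)"
    using assms nonneg by (intro sum_mono2) auto
  moreover have "0 \<le> (\<Sum>j=1..i. omega p (item t j) t)"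
    using assms nonneg by (intro sum_nonneg) auto
  ultimately show ?thesis
    unfolding b_sup_def upper_triangle_closed_form using assms utility_nonneg
    by (intro add_mono mult_mono) (auto intro!: binomial_right_mono)
qed

lemma b_sup_nonneg: "i \<le> tlen t \<Longrightarrow> 0 \<le> b_sup p t \<phi> l i"
  using b_sup_mono[of 0 i \<phi> "l - 1"] by (cases l) (simp_all add: utility_nonneg)

text \<open>For i < k, b_sup(i) <= b_sup(k-1) = b_inf(k), so the two intervals are disjoint.\<close>

lemma is_jump_unique:
  assumes "is_jump p t \<phi> (Suc l) \<alpha> i" "is_jump p t \<phi> (Suc l) \<alpha> k"
  shows "i = k"
proof -
  have False if "is_jump p t \<phi> (Suc l) \<alpha> i" "is_jump p t \<phi> (Suc l) \<alpha> k" "i < k" for i k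
  proof -
    have "i \<le> k - 1" "k - 1 \<le> tlen t" using that by (auto simp: is_jump_def)
    then have "b_sup p t \<phi> (Suc l) i \<le> b_sup p t \<phi> (Suc l) (k - 1)" by (rule b_sup_mono)
    then show False using that by (simp add: is_jump_def b_inf_eq_b_sup)
  qed
  then show ?thesis using assms by (metis linorder_neqE_nat)
qed

lemma jump_eq_Some_iff:
  "jump p t \<phi> (Suc l) j r = Some i \<longleftrightarrow> is_jump p t \<phi> (Suc l) (r * b_sup p t \<phi> (Suc l) j) i"
  (is "_ \<longleftrightarrow> ?J i")
proof -
  have "jump p t \<phi> (Suc l) j r = (if \<exists>!i. ?J i then Some (THE i. ?J i) else None)"
    by (simp add: jump_def b_sup_def)
  moreover have "(\<exists>!i. ?J i) \<and> (THE i. ?J i) = k" if "?J k" for k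
    using that is_jump_unique by (blast intro: the_equality)
  moreover have "?J (THE i. ?J i)" if "\<exists>!i. ?J i"
    using that by (rule theI')
  ultimately show ?thesis by auto
qed

lemma spmf_draw_index:
  assumes "j \<le> tlen t"
  shows "spmf (draw_index p t \<phi> (Suc l) j) i =
    (if i \<in> {1..j}
     then (b_sup p t \<phi> (Suc l) i - b_sup p t \<phi> (Suc l) (i - 1)) / b_sup p t \<phi> (Suc l) j else 0)"
proof -
  let ?B = "b_sup p t \<phi> (Suc l)"
  let ?S = "{0<..<1} \<inter> jump p t \<phi> (Suc l) j -` {Some i}"
  have jump_sets: "jump p t \<phi> (Suc l) j -` {Some i} \<in> sets borel"
    using measurable_sets[OF measurable_jump, of "{Some i}"] by simp
  have B_j: "0 \<le> ?B j" using assms by (rule b_sup_nonneg)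
  have jump_measurable:
    "jump p t \<phi> (Suc l) j \<in> measurable (uniform_measure lborel {0<..<1}) (count_space UNIV)"
    by (subst measurable_cong_sets [of _ borel _ "count_space UNIV"]) (simp_all add: measurable_jump)
  have "spmf (draw_index p t \<phi> (Suc l) j) i =
      measure (uniform_measure lborel {0<..<1}) (jump p t \<phi> (Suc l) j -` {Some i})"
    unfolding pmf.rep_eq measure_pmf_draw_index
    by (subst measure_distr[OF jump_measurable]) simp_all
  also have "\<dots> = measure lborel ?S"
    using jump_sets by (subst measure_uniform_measure) auto
  also have "\<dots> = (if i \<in> {1..j} then (?B i - ?B (i - 1)) / ?B j else 0)"
  proof (cases "i \<in> {1..j} \<and> ?B j \<noteq> 0")
    case True
    then have pos: "0 < ?B j" using B_j by simp
    have "?S = {?B (i - 1) / ?B j<..?B i / ?B j} \<inter> {0<..<1}"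
      using True assms pos
      by (auto simp: jump_eq_Some_iff is_jump_def b_inf_eq_b_sup field_simps)
    moreover have "0 \<le> ?B (i - 1) / ?B j" "?B (i - 1) / ?B j \<le> ?B i / ?B j" "?B i / ?B j \<le> 1"
      using True assms pos b_sup_mono[of "i - 1" i \<phi> l] b_sup_mono[of i j \<phi> l]
        b_sup_nonneg[of "i - 1" \<phi> "Suc l"]
      by (auto simp: divide_right_mono)
    ultimately show ?thesis
      using True measure_Ioc_inter_unit by (simp add: diff_divide_distrib)
  next
    \<comment> \<open>This covers i outside 1..j and also b_sup(j) = 0: then \<alpha> = 0 lies in no
      interval, and the quotient is 0 as well.\<close>
    case False
    have "?S = {}"
    proof (rule ccontr)
      assume "?S \<noteq> {}"
      then obtain r where r: "0 < r" "r < 1" and i: "1 \<le> i" "i \<le> tlen t"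
        and lt: "?B (i - 1) < r * ?B j"
        by (auto simp: jump_eq_Some_iff is_jump_def b_inf_eq_b_sup)
      have "0 \<le> ?B (i - 1)" using i by (intro b_sup_nonneg) simp
      with lt r B_j have "?B j \<noteq> 0" by auto
      with False i have "?B j \<le> ?B (i - 1)" by (intro b_sup_mono) auto
      moreover have "r * ?B j \<le> ?B j" using r B_j by (simp add: mult_left_le_one_le)
      ultimately show False using lt by simp
    qed
    then show ?thesis using False by auto
  qed
  finally show ?thesis .
qed

lemma set_draw_index: "j \<le> tlen t \<Longrightarrow> set_spmf (draw_index p t \<phi> (Suc l) j) \<subseteq> {1..j}"
  by (auto simp: in_set_spmf_iff_spmf spmf_draw_index split: if_splits)

section \<open>The outcomes of the loop and their probabilities\<close>

text \<open>Every round resumes strictly below the chosen position, so the added items are distinct.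
  \<open>\<phi>\<close> may overlap with them here, so the cardinality is recorded for the added
  part \<open>A\<close>.\<close>

lemma set_qplus_loop:
  "j \<le> tlen t \<Longrightarrow>
    set_spmf (qplus_loop p t l j \<phi>) \<subseteq> (\<union>) \<phi> ` {A. A \<subseteq> item t ` {1..j} \<and> card A = l}"
proof (induction l arbitrary: j \<phi>)
  case 0
  then show ?case by (auto intro: image_eqI[where x = "{}"])
next
  case (Suc l)
  show ?case
  proof
    fix \<psi> assume "\<psi> \<in> set_spmf (qplus_loop p t (Suc l) j \<phi>)"
    then obtain i where i: "i \<in> {1..j}"
      and "\<psi> \<in> set_spmf (qplus_loop p t l (i - 1) ({item t i} \<union> \<phi>))"
      using set_draw_index[OF Suc.prems, of \<phi> l]
      unfolding qplus_loop.simps set_bind_spmf bind_UNION by auto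
    moreover have "i - 1 \<le> tlen t" using i Suc.prems by auto
    ultimately obtain A where A: "A \<subseteq> item t ` {1..i - 1}" "card A = l"
      and \<psi>: "\<psi> = {item t i} \<union> \<phi> \<union> A"
      using Suc.IH by blast
    have "item t i \<notin> A"
      using A i Suc.prems by (force simp: item_eq_iff)
    moreover have "finite A" using A finite_surj by blast
    ultimately have "card (insert (item t i) A) = Suc l" using A by simp
    moreover have "insert (item t i) A \<subseteq> item t ` {1..j}"
      using A i by fastforce
    ultimately show "\<psi> \<in> (\<union>) \<phi> ` {A. A \<subseteq> item t ` {1..j} \<and> card A = Suc l}"
      using \<psi> by (intro image_eqI[where x = "insert (item t i) A"]) auto
  qed
qed

text \<open>Multiplied out rather than divided by \<open>b_sup\<close>: in this form the invariant also holds for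
  \<open>l = 0\<close> and when the normalising constant vanishes, so that the loop fails.\<close>

lemma spmf_qplus_loop:
  assumes "\<phi> \<subseteq> dom t" "j \<le> tlen t" "\<phi> \<inter> item t ` {1..j} = {}" "A \<subseteq> item t ` {1..j}" "card A = l"
  shows "b_sup p t \<phi> l j * spmf (qplus_loop p t l j \<phi>) (\<phi> \<union> A) = utility p (\<phi> \<union> A) t"
  using assms
proof (induction l arbitrary: j \<phi> A)
  case 0
  \<comment> \<open>\<open>card A = 0\<close> yields \<open>A = {}\<close> only for finite
    \<open>A\<close>.\<close>
  then have "finite A" using finite_surj by blast
  with 0 show ?case by simp
next
  case (Suc l)
  let ?B = "b_sup p t \<phi> (Suc l)"
  define I where "I = {i \<in> {1..j}. item t i \<in> A}"
  \<comment> \<open>Positions decrease along the loop, so \<open>A\<close> can only arise by jumping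
    first to its last position.\<close>
  define m where "m = Max I"
  have finI: "finite I" and A_eq: "A = item t ` I"
    using Suc.prems by (auto simp: I_def)
  have "I \<noteq> {}" using A_eq Suc.prems by auto
  with finI have mI: "m \<in> I" and m_max: "\<And>i. i \<in> I \<Longrightarrow> i \<le> m"
    by (auto simp: m_def)
  have m: "1 \<le> m" "m \<le> j" "m \<le> tlen t" "item t m \<in> A"
    using mI Suc.prems by (auto simp: I_def)
  define \<psi> where "\<psi> = insert (item t m) \<phi>"
  define A' where "A' = A - {item t m}"
  have union: "\<phi> \<union> A = \<psi> \<union> A'" using m by (auto simp: \<psi>_def A'_def)
  have m_notin: "item t m \<notin> \<phi>" using m Suc.prems by auto
  have m_dom: "item t m \<in> dom t" using m by (intro item_in_dom)
  have A'_sub: "A' \<subseteq> item t ` {1..m - 1}"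
  proof
    fix X assume "X \<in> A'"
    then obtain i where i: "i \<in> I" "X = item t i" "i \<noteq> m" by (auto simp: A'_def A_eq)
    with m_max[of i] have "i \<in> {1..m - 1}" by (auto simp: I_def)
    with i show "X \<in> item t ` {1..m - 1}" by blast
  qed
  have IH: "b_sup p t \<psi> l (m - 1) * spmf (qplus_loop p t l (m - 1) \<psi>) (\<psi> \<union> A') = utility p (\<psi> \<union> A') t"
  proof (rule Suc.IH)
    show "\<psi> \<subseteq> dom t" using m_dom Suc.prems by (simp add: \<psi>_def)
    show "m - 1 \<le> tlen t" using m by simp
    have "item t m \<notin> item t ` {1..m - 1}" using m by (auto simp: item_eq_iff)
    moreover have "item t ` {1..m - 1} \<subseteq> item t ` {1..j}" using m by (intro image_mono) auto
    ultimately show "\<psi> \<inter> item t ` {1..m - 1} = {}"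
      using Suc.prems unfolding \<psi>_def by blast
    show "A' \<subseteq> item t ` {1..m - 1}" by (rule A'_sub)
    show "card A' = l" using Suc.prems m by (simp add: A'_def)
  qed
  have step: "?B m - ?B (m - 1) = b_sup p t \<psi> l (m - 1)"
    using b_sup_Suc_diff[of p \<psi> t "m - 1" \<phi> l] utility_insert[OF _ m_dom m_notin] m Suc.prems
    by (simp add: \<psi>_def)
  \<comment> \<open>After a jump to i only items below position i are added. Since t[i] must belong
    to \<open>A\<close>, i < m, and then t[m] is out of reach.\<close>
  have other: "spmf (qplus_loop p t l (i - 1) ({item t i} \<union> \<phi>)) (\<phi> \<union> A) = 0"
    if i: "i \<in> {1..j} - {m}" for i
  proof (rule ccontr)
    assume "\<not> ?thesis"
    then have "\<phi> \<union> A \<in> set_spmf (qplus_loop p t l (i - 1) ({item t i} \<union> \<phi>))"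
      by (simp add: in_set_spmf_iff_spmf)
    moreover have "set_spmf (qplus_loop p t l (i - 1) ({item t i} \<union> \<phi>)) \<subseteq>
        (\<union>) ({item t i} \<union> \<phi>) ` {A. A \<subseteq> item t ` {1..i - 1} \<and> card A = l}"
      using i Suc.prems by (intro set_qplus_loop) auto
    ultimately have "\<phi> \<union> A \<in>
        (\<union>) ({item t i} \<union> \<phi>) ` {A. A \<subseteq> item t ` {1..i - 1} \<and> card A = l}"
      by (rule rev_subsetD)
    then obtain A'' where A'': "A'' \<subseteq> item t ` {1..i - 1}"
      and eq: "\<phi> \<union> A = {item t i} \<union> \<phi> \<union> A''"
      by (elim imageE CollectE conjE) (rule that)
    have sub: "insert (item t i) A'' \<subseteq> item t ` {1..i}" using A'' i by fastforce
    have "item t i \<in> \<phi> \<union> A" unfolding eq by simp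
    moreover have "item t i \<notin> \<phi>" using i Suc.prems by auto
    ultimately have "item t i \<in> A" by blast
    then have "i < m" using m_max[of i] i by (force simp: I_def)
    have "item t m \<in> {item t i} \<union> \<phi> \<union> A''" unfolding eq[symmetric] using m by blast
    with m_notin have "item t m \<in> insert (item t i) A''" by blast
    then obtain k where "k \<in> {1..i}" "item t m = item t k" using sub by blast
    then show False using \<open>i < m\<close> m by (auto simp: item_eq_iff)
  qed
  have "spmf (qplus_loop p t (Suc l) j \<phi>) (\<phi> \<union> A) =
      (\<Sum>i\<in>{1..j}. spmf (draw_index p t \<phi> (Suc l) j) i *
        spmf (qplus_loop p t l (i - 1) ({item t i} \<union> \<phi>)) (\<phi> \<union> A))"
    using set_draw_index[OF \<open>j \<le> tlen t\<close>] by (auto intro!: spmf_bind_finite)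
  also have "\<dots> = spmf (draw_index p t \<phi> (Suc l) j) m * spmf (qplus_loop p t l (m - 1) \<psi>) (\<phi> \<union> A)"
    using m other by (subst sum.remove[of _ m]) (simp_all add: \<psi>_def del: One_nat_def)
  also have "\<dots> = b_sup p t \<psi> l (m - 1) / ?B j * spmf (qplus_loop p t l (m - 1) \<psi>) (\<psi> \<union> A')"
    using m by (simp add: spmf_draw_index[OF \<open>j \<le> tlen t\<close>] step union del: One_nat_def)
  also have "\<dots> = utility p (\<phi> \<union> A) t / ?B j"
    by (simp add: union flip: IH)
  finally have "?B j * spmf (qplus_loop p t (Suc l) j \<phi>) (\<phi> \<union> A) =
      ?B j * (utility p (\<phi> \<union> A) t / ?B j)"
    by (rule arg_cong)
  \<comment> \<open>Monotonicity squeezes b_sup(m) and b_sup(m-1) between 0 and b_sup(j) = 0. So the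
    constant of the next round is 0, and the multiplied-out induction hypothesis gives utility
    0.\<close>
  moreover have "utility p (\<phi> \<union> A) t = 0" if "?B j = 0"
  proof -
    have "m - 1 \<le> tlen t" using m by simp
    then have "?B m - ?B (m - 1) = 0"
      using that m \<open>j \<le> tlen t\<close> b_sup_mono[of m j \<phi> l] b_sup_nonneg[of "m - 1" \<phi> "Suc l"]
        b_sup_mono[of "m - 1" m \<phi> l] by simp
    then show ?thesis using IH step union by simp
  qed
  ultimately show ?case by (cases "?B j = 0") auto
qed

section \<open>The values V_t(l,|t|) as totals over a whole transaction\<close>

text \<open>The empty set has utility 0, so for it \<open>b_sup\<close> reduces to
  \<open>upper_triangle\<close>.\<close>

lemma upper_triangle_nonneg: "0 \<le> upper_triangle p t l (tlen t)"
  using b_sup_nonneg[of "tlen t" "{}" l] by (simp add: b_sup_def utility_def)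

lemma spmf_qplus_loop_start:
  assumes "\<phi> \<subseteq> dom t"
  shows "upper_triangle p t (card \<phi>) (tlen t) *
    spmf (qplus_loop p t (card \<phi>) (tlen t) {}) \<phi> = utility p \<phi> t"
  using spmf_qplus_loop[of "{}" "tlen t" \<phi> "card \<phi>"] assms
  by (simp add: item_image b_sup_def utility_def del: One_nat_def)

lemma set_qplus_loop_start:
  "set_spmf (qplus_loop p t l (tlen t) {}) \<subseteq> {\<phi>. \<phi> \<subseteq> dom t \<and> card \<phi> = l}"
  using set_qplus_loop[of "tlen t" l "{}"] by (simp add: item_image del: One_nat_def)

text \<open>Both sides are (|t|-1 choose l-1) times the sum of omega over t, the left by the closed
  form and the right by double counting.\<close>

lemma upper_triangle_eq_sum_utility:
  assumes "1 \<le> l"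
  shows "upper_triangle p t l (tlen t) = (\<Sum>\<phi> | \<phi> \<subseteq> dom t \<and> card \<phi> = l. utility p \<phi> t)"
proof -
  obtain k where l: "l = Suc k" using assms by (cases l) auto
  have "(\<Sum>\<phi> | \<phi> \<subseteq> dom t \<and> card \<phi> = l. utility p \<phi> t) =
      (\<Sum>\<phi> | \<phi> \<subseteq> dom t \<and> card \<phi> = Suc k. \<Sum>X\<in>\<phi>. omega p X t)"
    by (intro sum.cong) (auto simp: utility_def l)
  also have "\<dots> = real ((tlen t - 1) choose k) * (\<Sum>X\<in>dom t. omega p X t)"
    using finite_dom by (simp add: sum_sum_subsets_card tlen_def)
  also have "(\<Sum>X\<in>dom t. omega p X t) = (\<Sum>j=1..tlen t. omega p (item t j) t)"
    by (rule sum.reindex_bij_betw[OF bij_betw_item, symmetric])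
  finally show ?thesis by (simp add: l upper_triangle_closed_form)
qed

end

section \<open>The length draw followed by the loop\<close>

text \<open>\<open>1 \<le> \<mu>\<close> keeps all lengths in range positive, where
  \<open>length_utility\<close> controls the sign of \<open>L\<close>.\<close>

locale weighted_lengths = weighted_transaction +
  fixes L :: "nat \<Rightarrow> real" and \<mu> M :: nat
  assumes \<mu>_pos: "1 \<le> \<mu>" and length_utility: "length_utility \<mu> M L"
begin

lemma L_nonneg: "1 \<le> l \<Longrightarrow> 0 \<le> L l"
  using length_utility by (simp add: length_utility_def)

lemma trans_weight_nonneg: "0 \<le> trans_weight p L \<mu> M t"
  unfolding trans_weight_def using \<mu>_pos
  by (intro sum_nonneg mult_nonneg_nonneg upper_triangle_nonneg L_nonneg) auto

lemma trans_weight_eq_sum_utility: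
  "trans_weight p L \<mu> M t =
    (\<Sum>\<phi> | \<phi> \<subseteq> dom t \<and> card \<phi> \<in> {\<mu>..M}. utility p \<phi> t * L (card \<phi>))"
proof -
  let ?F = "{\<phi>. \<phi> \<subseteq> dom t \<and> card \<phi> \<in> {\<mu>..M}}"
  have "(\<Sum>\<phi>\<in>?F. utility p \<phi> t * L (card \<phi>)) =
      (\<Sum>l\<in>{\<mu>..M}. \<Sum>\<phi>\<in>{\<phi> \<in> ?F. card \<phi> = l}. utility p \<phi> t * L (card \<phi>))"
    using finite_dom by (intro sum.group[symmetric]) auto
  also have "\<dots> = (\<Sum>l\<in>{\<mu>..M}. \<Sum>\<phi> | \<phi> \<subseteq> dom t \<and> card \<phi> = l. utility p \<phi> t * L l)"
    by (intro sum.cong refl) auto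
  also have "\<dots> = trans_weight p L \<mu> M t"
    unfolding trans_weight_def using \<mu>_pos
    by (intro sum.cong refl) (simp add: upper_triangle_eq_sum_utility sum_distrib_right)
  finally show ?thesis by simp
qed

lemma spmf_draw_length:
  "spmf (draw_length p L \<mu> M t) l =
    (if l \<in> {\<mu>..M} then upper_triangle p t l (tlen t) * L l / trans_weight p L \<mu> M t else 0)"
proof -
  let ?f = "\<lambda>l. if l \<in> {\<mu>..M} then upper_triangle p t l (tlen t) * L l / trans_weight p L \<mu> M t else 0"
  \<comment> \<open>The quotient is 1, or 0 when W(t) = 0.\<close>
  have "sum ?f {\<mu>..M} = trans_weight p L \<mu> M t / trans_weight p L \<mu> M t"
    by (simp add: trans_weight_def flip: sum_divide_distrib)
  then have "sum ?f {\<mu>..M} \<le> 1" by simp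
  moreover have "0 \<le> ?f l" for l
    using \<mu>_pos upper_triangle_nonneg L_nonneg trans_weight_nonneg by simp
  ultimately show ?thesis
    unfolding draw_length_def by (intro spmf_embed_spmf_finite[of "{\<mu>..M}"]) auto
qed

lemma set_draw_length: "set_spmf (draw_length p L \<mu> M t) \<subseteq> {\<mu>..M}"
  by (auto simp: in_set_spmf_iff_spmf spmf_draw_length split: if_splits)

text \<open>Only the length |phi| can lead to phi, and V_t(|phi|,|t|) cancels between the length
  draw and the loop. The factor \<open>?W\<close> stands on the left so that a transaction of weight
  0 is covered.\<close>

lemma spmf_length_then_loop:
  assumes "card \<phi> \<in> {\<mu>..M}"
  shows "trans_weight p L \<mu> M t *
      spmf (bind_spmf (draw_length p L \<mu> M t) (\<lambda>l. qplus_loop p t l (tlen t) {})) \<phi> =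
    utility p \<phi> t * L (card \<phi>)" (is "?W * spmf ?Q \<phi> = _")
proof (cases "\<phi> \<subseteq> dom t")
  case False
  then have "\<phi> \<notin> set_spmf ?Q"
    using set_qplus_loop_start by (auto simp: set_bind_spmf)
  then show ?thesis using False by (simp add: spmf_eq_0_set_spmf utility_def)
next
  case True
  let ?V = "upper_triangle p t (card \<phi>) (tlen t)"
  have "spmf ?Q \<phi> = (\<Sum>l\<in>{card \<phi>}. spmf (draw_length p L \<mu> M t) l * spmf (qplus_loop p t l (tlen t) {}) \<phi>)"
    using set_qplus_loop_start by (intro spmf_bind_finite) (auto simp: in_set_spmf_iff_spmf[symmetric])
  then have Q: "?W * spmf ?Q \<phi> =
      ?W * (?V * L (card \<phi>) / ?W) * spmf (qplus_loop p t (card \<phi>) (tlen t) {}) \<phi>"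
    using assms by (simp add: spmf_draw_length)
  \<comment> \<open>A vanishing sum of nonnegative terms has only zero terms, so cancelling
    \<open>?W\<close> is sound even if it is 0.\<close>
  have "?V * L (card \<phi>) = 0" if "?W = 0"
  proof -
    have "\<forall>l\<in>{\<mu>..M}. upper_triangle p t l (tlen t) * L l = 0"
      using that \<mu>_pos upper_triangle_nonneg L_nonneg unfolding trans_weight_def
      by (subst (asm) sum_nonneg_eq_0_iff) auto
    then show ?thesis using assms by blast
  qed
  then have "?W * (?V * L (card \<phi>) / ?W) = ?V * L (card \<phi>)" by (cases "?W = 0") auto
  with Q show ?thesis
    using spmf_qplus_loop_start[OF True] by (simp add: algebra_simps)
qed

end

section \<open>Summation over the database\<close>

text \<open>The form with multiplicities matches \<open>draw_transaction\<close>, whose mass at t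
  contains \<open>count D t\<close>.\<close>

lemma sum_mset_eq_sum_count:
  fixes f :: "'b \<Rightarrow> real"
  shows "(\<Sum>x\<in>#A. f x) = (\<Sum>x\<in>set_mset A. real (count A x) * f x)"
proof (induction A)
  case (add a A)
  \<comment> \<open>Summing over \<open>insert a\<close> treats a new and a repeated
    \<open>a\<close> alike, as \<open>count A a = 0\<close> for a new one; the conditional term is
    the extra copy.\<close>
  have "(\<Sum>x\<in>set_mset (add_mset a A). real (count (add_mset a A) x) * f x) =
      (\<Sum>x\<in>insert a (set_mset A). real (count A x) * f x + (if x = a then f a else 0))"
    by (intro sum.cong) (auto simp: algebra_simps)
  also have "\<dots> = (\<Sum>x\<in>set_mset A. real (count A x) * f x) + f a"
    by (simp add: sum.distrib sum.insert_if not_in_iff)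
  finally show ?case using add by simp
qed simp

theorem mainTheorem3:
  fixes p :: "'a::{finite,linorder} \<Rightarrow> real"
    and D :: "'a transaction multiset"
    and L :: "nat \<Rightarrow> real"
    and \<mu> M :: nat
  assumes weights: "\<And>X. p X > 0"
    and quantities: "\<And>t X. t \<in># D \<Longrightarrow> X \<in> dom t \<Longrightarrow> the (t X) \<ge> 0"
    and range: "1 \<le> \<mu>" "\<mu> \<le> M"
    and len: "length_utility \<mu> M L"
  shows "set_spmf (QPlus p L D \<mu> M) \<subseteq> patterns \<mu> M D \<and>
    (\<forall>\<phi> \<in> patterns \<mu> M D.
       spmf (QPlus p L D \<mu> M) \<phi> =
         weighted_utility p L D \<phi> / (\<Sum>\<phi>'\<in>patterns \<mu> M D. weighted_utility p L D \<phi>'))"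
proof -
  let ?W = "trans_weight p L \<mu> M"
  let ?Z = "\<Sum>t\<in>#D. ?W t"
  have wl: "weighted_lengths p t L \<mu> M" if "t \<in># D" for t
    using that weights quantities range len
    by unfold_locales (auto simp: omega_def intro!: mult_nonneg_nonneg less_imp_le[OF weights])
  note W_nonneg = weighted_lengths.trans_weight_nonneg[OF wl]
  have Z_count: "?Z = (\<Sum>t\<in>set_mset D. real (count D t) * ?W t)"
    by (rule sum_mset_eq_sum_count)
  have Z_nonneg: "0 \<le> ?Z"
    unfolding Z_count using W_nonneg by (intro sum_nonneg) simp
  have draw: "spmf (draw_transaction p L \<mu> M D) t = real (count D t) * ?W t / ?Z" for t
    unfolding draw_transaction_def
  proof (rule spmf_embed_spmf_finite[of "set_mset D"])
    show "0 \<le> real (count D t) * ?W t / ?Z" for t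
      using W_nonneg Z_nonneg by (cases "t \<in># D") (simp_all add: not_in_iff)
    show "(\<Sum>t\<in>set_mset D. real (count D t) * ?W t / ?Z) \<le> 1"
      by (simp add: Z_count flip: sum_divide_distrib)
  qed (simp_all add: not_in_iff)
  have set_draw: "set_spmf (draw_transaction p L \<mu> M D) \<subseteq> set_mset D"
    by (auto simp: in_set_spmf_iff_spmf draw)

  have support: "set_spmf (QPlus p L D \<mu> M) \<subseteq> patterns \<mu> M D"
  proof
    fix \<phi> assume "\<phi> \<in> set_spmf (QPlus p L D \<mu> M)"
    then obtain t l where t: "t \<in># D" and l: "l \<in> set_spmf (draw_length p L \<mu> M t)"
      and \<phi>: "\<phi> \<in> set_spmf (qplus_loop p t l (tlen t) {})"
      using set_draw by (auto simp: QPlus_def set_bind_spmf)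
    interpret weighted_lengths p t L \<mu> M using t by (rule wl)
    have "\<phi> \<subseteq> dom t" "card \<phi> \<in> {\<mu>..M}"
      using l \<phi> set_draw_length set_qplus_loop_start by blast+
    \<comment> \<open>The cardinality is at least \<mu> and hence positive, which excludes the empty
      set.\<close>
    then show "\<phi> \<in> patterns \<mu> M D" using t range by (auto simp: patterns_def)
  qed

  have Z_eq: "(\<Sum>\<phi>\<in>patterns \<mu> M D. weighted_utility p L D \<phi>) = ?Z"
  proof -
    have "(\<Sum>\<phi>\<in>patterns \<mu> M D. weighted_utility p L D \<phi>) =
        (\<Sum>\<phi>\<in>patterns \<mu> M D. \<Sum>t\<in>set_mset D. real (count D t) * (utility p \<phi> t * L (card \<phi>)))"
      by (simp add: weighted_utility_def db_utility_def sum_mset_eq_sum_count sum_distrib_right mult.assoc)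
    also have "\<dots> = (\<Sum>t\<in>set_mset D. real (count D t) *
        (\<Sum>\<phi>\<in>patterns \<mu> M D. utility p \<phi> t * L (card \<phi>)))"
      by (subst sum.swap) (simp add: sum_distrib_left)
    also have "\<dots> = (\<Sum>t\<in>set_mset D. real (count D t) * ?W t)"
    proof (intro sum.cong refl arg_cong2[where f = "(*)"])
      fix t assume t: "t \<in># D"
      interpret weighted_lengths p t L \<mu> M using t by (rule wl)
      \<comment> \<open>Patterns not contained in t have utility 0 in t, and every subset of t with
        length in range is a pattern of \<open>D\<close>.\<close>
      show "(\<Sum>\<phi>\<in>patterns \<mu> M D. utility p \<phi> t * L (card \<phi>)) = ?W t"
        unfolding trans_weight_eq_sum_utility using t range
        by (intro sum.mono_neutral_right) (auto simp: patterns_def utility_def)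
    qed
    finally show ?thesis by (simp add: Z_count)
  qed

  have "spmf (QPlus p L D \<mu> M) \<phi> = weighted_utility p L D \<phi> / ?Z" if \<phi>: "\<phi> \<in> patterns \<mu> M D" for \<phi>
  proof -
    let ?Q = "\<lambda>t. bind_spmf (draw_length p L \<mu> M t) (\<lambda>l. qplus_loop p t l (tlen t) {})"
    have "spmf (QPlus p L D \<mu> M) \<phi> =
        (\<Sum>t\<in>set_mset D. spmf (draw_transaction p L \<mu> M D) t * spmf (?Q t) \<phi>)"
      unfolding QPlus_def using set_draw by (intro spmf_bind_finite) auto
    also have "\<dots> = (\<Sum>t\<in>set_mset D. real (count D t) * (?W t * spmf (?Q t) \<phi>) / ?Z)"
      by (simp add: draw mult.assoc)
    \<comment> \<open>Here W(t) cancels term by term, also where it is 0. If \<open>?Z\<close> is 0,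
      the transaction draw fails and both sides are 0.\<close>
    also have "\<dots> = (\<Sum>t\<in>set_mset D. real (count D t) * (utility p \<phi> t * L (card \<phi>)) / ?Z)"
      using \<phi> by (intro sum.cong refl)
        (simp add: weighted_lengths.spmf_length_then_loop[OF wl] patterns_def)
    also have "\<dots> = weighted_utility p L D \<phi> / ?Z"
      by (simp add: weighted_utility_def db_utility_def sum_mset_eq_sum_count sum_distrib_right
          mult.assoc sum_divide_distrib)
    finally show ?thesis .
  qed
  with support Z_eq show ?thesis by simp
qed

end
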